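(* Let $F$ be a free filter on $\omega$ such that $F\le_K\mathcal{Z}^*$. If $X$ is a Tychonoff space such that $N_F$ homeomorphically embeds into $X$, then $C_p^*(X)$ contains a complemented copy of the space $(c_0)_p$.
   Context: A filter $F$ on $\omega$ is free if $\bigcap F=\emptyset$ (equivalently, $F$ contains every cofinite set); filters are proper. For free filters $F,G$ on $\omega$, $F\le_K G$ means there is $f:\omega\to\omega$ such that $f^{-1}[A]\in G$ for every $A\in F$. $\mathcal{Z}=\{A\subseteq\omega:\limsup_{n\to\infty}|A\cap[0,n)|/n=0\}$ is the asymptotic density ideal and $\mathcal{Z}^*=\{A\subseteq\omega:\omega\setminus A\in\mathcal{Z}\}$ its dual filter. For a free filter $F$ on $\omega$, $N_F=\omega\cup\{p_F\}$, $p_F\notin\omega$, with the topology in which every point of $\omega$ is isolated and the open neighborhoods of $p_F$ are exactly the sets $A\cup\{p_F\}$ with $A\in F$. $C_p^*(X)$ is the space of all bounded continuous real-valued functions on $X$ with the topology of pointwise convergence. $(c_0)_p=\{x\in\mathbb{R}^\omega: x(n)\to0\}$ with the pointwise topology (inherited from $\mathbb{R}^\omega$). A topological vector space $E$ contains a complemented copy of $(c_0)_p$ if there is a closed linear subspace $Y$ of $E$ such that $E$ is linearly homeomorphic to $Y\times(c_0)_p$ (equivalently, there is a continuous linear projection of $E$ onto a subspace linearly homeomorphic to $(c_0)_p$). *)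

theory Defs
  imports "HOL-Analysis.Analysis" "HOL-Library.Function_Algebras"
begin

section \<open>Filters on the natural numbers\<close>

text \<open>
  A set \<open>A\<close> belongs to the filter \<open>F\<close> iff \<open>\<forall>\<^sub>F n in F. n \<in> A\<close>. The type of filters
  includes the improper filter \<open>bot\<close>, which has to be excluded.
\<close>

definition free_filter :: "nat filter \<Rightarrow> bool" where
  "free_filter F \<longleftrightarrow> F \<noteq> bot \<and> \<Inter> {A. \<forall>\<^sub>F n in F. n \<in> A} = {}"

definition katetov_le :: "nat filter \<Rightarrow> nat filter \<Rightarrow> bool" (infix \<open>\<le>\<^sub>K\<close> 50) where
  "F \<le>\<^sub>K G \<longleftrightarrow> (\<exists>f :: nat \<Rightarrow> nat. \<forall>A. (\<forall>\<^sub>F n in F. n \<in> A) \<longrightarrow> (\<forall>\<^sub>F n in G. n \<in> f -` A))"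

lemma katetov_le_iff_filterlim: "F \<le>\<^sub>K G \<longleftrightarrow> (\<exists>f. filterlim f F G)"
proof -
  have "(\<forall>A. (\<forall>\<^sub>F n in F. n \<in> A) \<longrightarrow> (\<forall>\<^sub>F n in G. n \<in> f -` A)) \<longleftrightarrow> filterlim f F G" for f :: "nat \<Rightarrow> nat"
    unfolding filterlim_iff
  proof (intro iffI allI impI)
    fix P assume "\<forall>A. (\<forall>\<^sub>F n in F. n \<in> A) \<longrightarrow> (\<forall>\<^sub>F n in G. n \<in> f -` A)" "eventually P F"
    then show "\<forall>\<^sub>F x in G. P (f x)"
      by (auto dest: spec[of _ "Collect P"])
  qed auto
  then show ?thesis
    by (simp add: katetov_le_def)
qed

definition density_ideal :: "nat set set" where
  "density_ideal = {A. limsup (\<lambda>n. ereal (real (card (A \<inter> {0..<n})) / real n)) = 0}"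

definition density_filter :: "nat filter" where
  "density_filter = Abs_filter (\<lambda>P. UNIV - {n. P n} \<in> density_ideal)"

lemma density_ideal_iff:
  "A \<in> density_ideal \<longleftrightarrow> (\<lambda>n. real (card (A \<inter> {0..<n})) / real n) \<longlonglongrightarrow> 0"
proof -
  let ?d = "\<lambda>n. ereal (real (card (A \<inter> {0..<n})) / real n)"
  have "0 \<le> liminf ?d"
    by (rule Liminf_bounded) auto
  then have "limsup ?d = 0 \<longleftrightarrow> ?d \<longlonglongrightarrow> 0"
    using Liminf_le_Limsup[of sequentially ?d] lim_imp_Limsup[of sequentially ?d 0]
      Liminf_eq_Limsup[of sequentially ?d 0]
    by (auto intro: antisym)
  then show ?thesis
    by (simp add: density_ideal_def zero_ereal_def)
qed

lemma density_ideal_subset: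
  assumes "A \<in> density_ideal" "B \<subseteq> A"
  shows "B \<in> density_ideal"
  unfolding density_ideal_iff
proof (rule tendsto_sandwich[OF _ _ tendsto_const])
  show "(\<lambda>n. real (card (A \<inter> {0..<n})) / real n) \<longlonglongrightarrow> 0"
    using assms(1) by (simp add: density_ideal_iff)
  show "\<forall>\<^sub>F n in sequentially. real (card (B \<inter> {0..<n})) / real n \<le> real (card (A \<inter> {0..<n})) / real n"
    using assms(2) by (intro always_eventually allI divide_right_mono of_nat_mono card_mono) auto
qed auto

lemma density_ideal_Un:
  assumes "A \<in> density_ideal" "B \<in> density_ideal"
  shows "A \<union> B \<in> density_ideal"
  unfolding density_ideal_iff
proof (rule tendsto_sandwich[OF _ _ tendsto_const])
  show "(\<lambda>n. real (card (A \<inter> {0..<n})) / real n + real (card (B \<inter> {0..<n})) / real n) \<longlonglongrightarrow> 0"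
    using tendsto_add[of _ 0 _ _ 0] assms by (simp add: density_ideal_iff)
  have "card ((A \<union> B) \<inter> {0..<n}) \<le> card (A \<inter> {0..<n}) + card (B \<inter> {0..<n})" for n
    by (metis Int_Un_distrib2 card_Un_le)
  then show "\<forall>\<^sub>F n in sequentially. real (card ((A \<union> B) \<inter> {0..<n})) / real n
      \<le> real (card (A \<inter> {0..<n})) / real n + real (card (B \<inter> {0..<n})) / real n"
    unfolding add_divide_distrib[symmetric] of_nat_add[symmetric]
    by (intro always_eventually allI divide_right_mono of_nat_mono) auto
qed auto

lemma eventually_density_filter:
  "eventually P density_filter \<longleftrightarrow> UNIV - {n. P n} \<in> density_ideal"
  unfolding density_filter_def
proof (rule eventually_Abs_filter, rule is_filter.intro)
  show "UNIV - {n::nat. True} \<in> density_ideal"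
    by (simp add: density_ideal_iff)
  fix P Q :: "nat \<Rightarrow> bool"
  assume P: "UNIV - {n. P n} \<in> density_ideal"
  {
    assume "UNIV - {n. Q n} \<in> density_ideal"
    with P show "UNIV - {n. P n \<and> Q n} \<in> density_ideal"
      by (rule density_ideal_subset[OF density_ideal_Un]) auto
  }
  {
    assume "\<forall>n. P n \<longrightarrow> Q n"
    with P show "UNIV - {n. Q n} \<in> density_ideal"
      by (auto elim: density_ideal_subset)
  }
qed

section \<open>The space of a filter\<close>

text \<open>The points of \<open>\<omega>\<close> are the \<open>Some n\<close>, and \<open>None\<close> is the point \<open>p\<^sub>F\<close>.\<close>

definition filter_space :: "nat filter \<Rightarrow> nat option topology" where
  "filter_space F = topology (\<lambda>U. None \<in> U \<longrightarrow> (\<forall>\<^sub>F n in F. Some n \<in> U))"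

lemma openin_filter_space:
  "openin (filter_space F) U \<longleftrightarrow> (None \<in> U \<longrightarrow> (\<forall>\<^sub>F n in F. Some n \<in> U))"
proof -
  have "istopology (\<lambda>U. None \<in> U \<longrightarrow> (\<forall>\<^sub>F n in F. Some n \<in> U))"
    unfolding istopology_def
  proof (intro conjI allI impI)
    fix K :: "nat option set set"
    assume K: "\<forall>U\<in>K. None \<in> U \<longrightarrow> (\<forall>\<^sub>F n in F. Some n \<in> U)" and "None \<in> \<Union>K"
    then obtain U where "U \<in> K" "\<forall>\<^sub>F n in F. Some n \<in> U"
      by auto
    then show "\<forall>\<^sub>F n in F. Some n \<in> \<Union>K"
      by (auto elim!: eventually_mono)
  qed (auto intro: eventually_conj)
  then show ?thesis
    by (simp add: filter_space_def)
qed

lemma topspace_filter_space: "topspace (filter_space F) = UNIV"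
proof -
  have "openin (filter_space F) UNIV"
    by (simp add: openin_filter_space)
  then show ?thesis
    by (meson openin_subset top.extremum_unique)
qed

section \<open>Function spaces and complemented copies\<close>

text \<open>
  Function types carry the topology of pointwise convergence (an instance from HOL-Analysis) and
  pointwise addition; we add pointwise scalar multiplication.
\<close>

instantiation "fun" :: (type, real_vector) real_vector
begin

definition scaleR_fun :: "real \<Rightarrow> ('a \<Rightarrow> 'b) \<Rightarrow> 'a \<Rightarrow> 'b" where
  "scaleR_fun c f = (\<lambda>x. c *\<^sub>R f x)"

instance
  by standard (auto simp: scaleR_fun_def plus_fun_def fun_eq_iff scaleR_add_right scaleR_add_left)

end

text \<open>
  A function on \<open>topspace X\<close> is represented by its extension by \<open>0\<close> to the whole type. The
  coordinates outside \<open>topspace X\<close> are then constant, so that the subspace topology inherited from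
  the function type is that of pointwise convergence on \<open>topspace X\<close>.
\<close>

definition Cp_star :: "'a topology \<Rightarrow> ('a \<Rightarrow> real) set" where
  "Cp_star X = {f. continuous_map X euclideanreal f \<and> bounded (f ` topspace X)
                 \<and> (\<forall>x. x \<notin> topspace X \<longrightarrow> f x = 0)}"

definition c0_p :: "(nat \<Rightarrow> real) set" where
  "c0_p = {x. x \<longlonglongrightarrow> 0}"

lemma subspace_Cp_star: "subspace (Cp_star X)"
proof -
  have "bounded ((\<lambda>x. f x + g x) ` S)" if "bounded (f ` S)" "bounded (g ` S)"
    for f g :: "'a \<Rightarrow> real" and S
    using that by (rule bounded_plus_comp)
  moreover have "bounded ((\<lambda>x. c * f x) ` S)" if "bounded (f ` S)" for f :: "'a \<Rightarrow> real" and c S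
    using bounded_scaling[OF that, of c] by (simp add: image_image)
  moreover have "bounded ((\<lambda>x. 0 :: real) ` S)" for S :: "'a set"
    by (rule bounded_subset[of "{0}"]) auto
  ultimately show ?thesis
    unfolding subspace_def Cp_star_def
    by (auto simp: plus_fun_def zero_fun_def scaleR_fun_def
        intro: continuous_map_add continuous_map_real_mult_left)
qed

lemma subspace_c0_p: "subspace c0_p"
proof -
  have "(\<lambda>n. c * x n) \<longlonglongrightarrow> 0" if "x \<longlonglongrightarrow> 0" for c and x :: "nat \<Rightarrow> real"
    using tendsto_mult_left[OF that, of c] by simp
  moreover have "(\<lambda>n. x n + y n) \<longlonglongrightarrow> 0" if "x \<longlonglongrightarrow> 0" "y \<longlonglongrightarrow> 0" for x y :: "nat \<Rightarrow> real"
    using tendsto_add[OF that] by simp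
  ultimately show ?thesis
    by (auto simp: subspace_def c0_p_def plus_fun_def zero_fun_def scaleR_fun_def)
qed

text \<open>
  In the following two definitions, \<open>E\<close>, \<open>E'\<close> and \<open>C\<close> are meant to be linear subspaces of the
  ambient types, with the subspace topology.
\<close>

definition linearly_homeomorphic ::
    "'a::{real_vector, topological_space} set \<Rightarrow> 'b::{real_vector, topological_space} set \<Rightarrow> bool" where
  "linearly_homeomorphic E E' \<longleftrightarrow>
     (\<exists>h k. homeomorphism E E' h k
        \<and> (\<forall>x\<in>E. \<forall>y\<in>E. h (x + y) = h x + h y)
        \<and> (\<forall>c. \<forall>x\<in>E. h (c *\<^sub>R x) = c *\<^sub>R h x))"

definition contains_complemented_copy ::
    "'a::{real_vector, topological_space} set \<Rightarrow> 'b::{real_vector, topological_space} set \<Rightarrow> bool" where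
  "contains_complemented_copy E C \<longleftrightarrow>
     (\<exists>Y. Y \<subseteq> E \<and> subspace Y \<and> closedin (top_of_set E) Y \<and> linearly_homeomorphic E (Y \<times> C))"

end

theory Submission
  imports Defs
begin

text \<open>
  Let \<open>f\<close> witness \<open>F \<le>\<^sub>K \<Z>\<^sup>*\<close>. The averages of \<open>\<delta>\<^bsub>f(i)\<^esub> - \<delta>\<^bsub>p\<^esub>\<close> over \<open>i < n\<close> tend to \<open>0\<close> on bounded
  continuous functions, as \<open>g \<circ> f\<close> tends to \<open>g(p)\<close> off sets of density zero. Since \<open>f\<close> tends to infinity
  along \<open>\<Z>\<^sup>*\<close>, averaging over large subsets \<open>A\<^sub>k\<close> of fast growing initial segments keeps this property
  and makes the sets \<open>f[A\<^sub>k]\<close> disjoint. Complete regularity gives bump functions \<open>h\<^sub>k\<close> on \<open>X\<close> with disjoint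
  supports, biorthogonal to the averages \<open>\<nu>\<^sub>k\<close> over \<open>A\<^sub>k\<close>. Then \<open>g \<mapsto> (\<nu>\<^sub>k(g))\<^sub>k\<close> and \<open>a \<mapsto> \<Sum>\<^sub>k a\<^sub>k h\<^sub>k\<close> split off \<open>(c\<^sub>0)\<^sub>p\<close>.
\<close>

section \<open>Complements split off by a retraction\<close>

text \<open>As \<open>T\<close> inverts \<open>S\<close> on \<open>C\<close>, the composite of
  \<open>T\<close> followed by \<open>S\<close> is a continuous projection of \<open>E\<close>, and
  the kernel \<open>Y\<close> of \<open>T\<close> in \<open>E\<close> is the complement. Subtracting
  the projection splits \<open>g\<close> into its parts in \<open>Y\<close> and \<open>C\<close>;
  adding \<open>y\<close> and \<open>S a\<close> recombines them.\<close>

lemma contains_complemented_copy_retract: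
  fixes E :: "('a \<Rightarrow> real) set" and C :: "('b \<Rightarrow> real) set"
  assumes E: "subspace E"
    and T: "continuous_on UNIV T" "linear T" "T ` E \<subseteq> C"
    and S: "continuous_on UNIV S" "linear S" "S ` C \<subseteq> E"
    and TS: "\<And>a. a \<in> C \<Longrightarrow> T (S a) = a"
  shows "contains_complemented_copy E C"
proof -
  define Y where "Y = {g \<in> E. T g = 0}"
  have coord: "continuous_on A (\<lambda>z. u z i)" if "continuous_on A u"
    for A :: "'z::topological_space set" and u :: "'z \<Rightarrow> 'i \<Rightarrow> real" and i
    using that by (rule continuous_on_product_then_coordinatewise)
  have "closedin (top_of_set E) Y"
  proof -
    have "closed {g. T g i = 0}" for i
      by (intro closed_Collect_eq coord[OF T(1)] continuous_on_const)
    then have "closed (\<Inter>i. {g. T g i = 0})"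
      by blast
    moreover have "Y = E \<inter> (\<Inter>i. {g. T g i = 0})"
      by (auto simp: Y_def fun_eq_iff)
    ultimately show ?thesis
      by (simp add: closedin_closed_Int)
  qed
  moreover have "subspace Y"
    using E by (auto simp: Y_def subspace_def linear_0[OF T(2)] linear_add[OF T(2)] linear_cmul[OF T(2)])
  moreover have "linearly_homeomorphic E (Y \<times> C)"
    unfolding linearly_homeomorphic_def
  proof (intro exI conjI ballI allI)
    let ?h = "\<lambda>g. (g - S (T g), T g)" and ?k = "\<lambda>(y, a). y + S a"
    show "homeomorphism E (Y \<times> C) ?h ?k"
    proof (rule homeomorphismI)
      have "continuous_on E (\<lambda>g. S (T g))"
        using continuous_on_compose2[OF S(1) continuous_on_subset[OF T(1)]] by blast
      then have "continuous_on E (\<lambda>g. (g - S (T g)) i)" for i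
        unfolding minus_apply by (intro continuous_on_diff coord continuous_on_id)
      then have "continuous_on E (\<lambda>g. g - S (T g))"
        by (rule continuous_on_coordinatewise_then_product)
      then show "continuous_on E ?h"
        by (intro continuous_on_Pair continuous_on_subset[OF T(1)]) auto
      have "continuous_on (Y \<times> C) (\<lambda>z. S (snd z))"
        using continuous_on_compose2[OF S(1) continuous_on_snd[OF continuous_on_id]] by blast
      then have "continuous_on (Y \<times> C) (\<lambda>z. (fst z + S (snd z)) i)" for i
        unfolding plus_fun_apply by (intro continuous_on_add coord continuous_on_fst continuous_on_id)
      then have "continuous_on (Y \<times> C) (\<lambda>z. fst z + S (snd z))"
        by (rule continuous_on_coordinatewise_then_product)
      then show "continuous_on (Y \<times> C) ?k"
        by (simp add: case_prod_beta)
      show "?h ` E \<subseteq> Y \<times> C"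
        using E T(3) S(3) TS by (force simp: Y_def linear_diff[OF T(2)] intro: subspace_diff)
      show "?k ` (Y \<times> C) \<subseteq> E"
        using E S(3) by (auto simp: Y_def intro!: subspace_add)
      show "?k (?h g) = g" if "g \<in> E" for g
        by simp
      show "?h (?k z) = z" if "z \<in> Y \<times> C" for z
        using that TS by (auto simp: Y_def linear_add[OF T(2)])
    qed
  qed (simp_all add: linear_add[OF T(2)] linear_add[OF S(2)] linear_cmul[OF T(2)] linear_cmul[OF S(2)]
        scaleR_diff_right)
  ultimately show ?thesis
    unfolding contains_complemented_copy_def by (intro exI[of _ Y]) (auto simp: Y_def)
qed

section \<open>Functions with disjoint supports\<close>

text \<open>Disjointness of the supports makes each value of the series depend on a single coefficient.\<close>

lemma disjoint_series:
  fixes h :: "nat \<Rightarrow> 'a \<Rightarrow> real"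
  assumes cont: "\<And>k. continuous_map X euclideanreal (h k)"
    and bound: "\<And>k x. \<bar>h k x\<bar> \<le> 1"
    and outside: "\<And>k x. x \<notin> topspace X \<Longrightarrow> h k x = 0"
    and disjoint: "\<And>j k x. j \<noteq> k \<Longrightarrow> h j x = 0 \<or> h k x = 0"
  obtains S where "continuous_on UNIV S" "linear S" "S ` c0_p \<subseteq> Cp_star X"
    "\<And>a k x. h k x \<noteq> 0 \<Longrightarrow> S a x = a k * h k x" "\<And>a x. (\<And>k. h k x = 0) \<Longrightarrow> S a x = 0"
proof
  \<comment> \<open>\<open>\<kappa> x\<close> is the only index whose function is nonzero at
    \<open>x\<close>. If there is none, the choice is arbitrary but harmless, since
    \<open>h (\<kappa> x) x\<close> is then 0.\<close>
  define \<kappa> where "\<kappa> x = (SOME k. h k x \<noteq> 0)" for x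
  define S where "S a x = a (\<kappa> x) * h (\<kappa> x) x" for a :: "nat \<Rightarrow> real" and x
  have \<kappa>: "\<kappa> x = k" if "h k x \<noteq> 0" for k x
    using someI[of "\<lambda>k. h k x \<noteq> 0", OF that] disjoint[of "\<kappa> x" k x] that unfolding \<kappa>_def by blast
  show S_eq: "S a x = a k * h k x" if "h k x \<noteq> 0" for a k x
    using \<kappa>[OF that] by (simp add: S_def)
  show S_0: "S a x = 0" if "\<And>k. h k x = 0" for a x
    using that by (simp add: S_def)
  have "continuous_on UNIV (\<lambda>a. S a x)" for x
    unfolding S_def by (intro continuous_intros continuous_on_product_coordinates)
  then show "continuous_on UNIV S"
    by (rule continuous_on_coordinatewise_then_product)
  show "linear S"
    by (intro linearI) (auto simp: S_def plus_fun_def scaleR_fun_def algebra_simps)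
  show "S ` c0_p \<subseteq> Cp_star X"
  proof safe
    fix a assume "a \<in> c0_p"
    then have a: "a \<longlonglongrightarrow> 0"
      by (simp add: c0_p_def)
    then obtain B where B: "\<And>n. \<bar>a n\<bar> \<le> B"
      using convergent_imp_Bseq[of a] unfolding convergent_def Bseq_def real_norm_def by blast
    have "\<bar>S a x\<bar> \<le> B" for x
      using mult_mono[OF B[of "\<kappa> x"] bound[of "\<kappa> x" x]] B[of 0] by (simp add: S_def abs_mult)
    then have "bounded (S a ` topspace X)"
      by (auto simp: bounded_iff)
    moreover have "continuous_map X euclideanreal (S a)"
    proof -
      \<comment> \<open>Continuity comes from uniform convergence of the partial sums: at each point
        the tail after \<open>n\<close> terms is either 0 or a single term with coefficient
        \<open>a k\<close>, \<open>k \<ge> n\<close>, and these coefficients tend to 0.\<close>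
      define s where "s n x = (\<Sum>k<n. a k * h k x)" for n x
      have s: "s n x = (if \<kappa> x < n then S a x else 0)" for n x
      proof -
        have "a k * h k x = (if k = \<kappa> x then S a x else 0)" for k
          using \<kappa>[of k x] by (auto simp: S_def)
        then show ?thesis
          by (simp add: s_def)
      qed
      have ev: "\<forall>\<^sub>F n in sequentially. \<forall>x\<in>topspace X. dist (s n x) (S a x) < e" if "0 < e" for e
      proof -
        obtain N where N: "\<And>n. n \<ge> N \<Longrightarrow> \<bar>a n\<bar> < e"
          using LIMSEQ_D[OF a \<open>0 < e\<close>] by auto
        have "dist (s n x) (S a x) < e" if "n \<ge> N" for n x
        proof (cases "\<kappa> x < n")
          case False
          have "\<bar>S a x\<bar> \<le> \<bar>a (\<kappa> x)\<bar>"
            using mult_left_mono[OF bound[of "\<kappa> x" x], of "\<bar>a (\<kappa> x)\<bar>"] by (simp add: S_def abs_mult)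
          with False N[of "\<kappa> x"] that show ?thesis
            by (simp add: s)
        qed (use \<open>0 < e\<close> in \<open>simp add: s\<close>)
        then show ?thesis
          by (auto simp: eventually_sequentially)
      qed
      have "continuous_map X euclideanreal (s n)" for n
        unfolding s_def by (intro continuous_map_sum continuous_map_real_mult_left cont) auto
      then show ?thesis
        using ev
        by (intro Met_TC.continuous_map_uniform_limit[unfolded mtopology_is_euclidean,
              where F = sequentially and f = s]) auto
    qed
    ultimately show "S a \<in> Cp_star X"
      using outside by (simp add: Cp_star_def S_def)
  qed
qed

text \<open>Complete regularity separates each \<open>x n\<close> from the rest of \<open>P\<close>,
  and cutting each function off where an earlier one exceeds 1/2 makes the supports disjoint. The
  cut does not affect the value at \<open>x n\<close>, because the earlier functions vanish there.
  \<open>P\<close> may be larger than the range of \<open>x\<close>, so that it can include a limit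
  point.\<close>

lemma disjoint_bumps:
  fixes x :: "nat \<Rightarrow> 'a"
  assumes X: "completely_regular_space X"
    and isolated: "\<And>n. \<exists>V. openin X V \<and> x n \<in> V \<and> V \<inter> P \<subseteq> {x n}"
    and x: "range x \<subseteq> P" "inj x"
  obtains \<phi> :: "nat \<Rightarrow> 'a \<Rightarrow> real"
  where "\<And>n. continuous_map X euclideanreal (\<phi> n)" "\<And>n y. 0 \<le> \<phi> n y" "\<And>n y. \<phi> n y \<le> 1"
    "\<And>n y. y \<notin> topspace X \<Longrightarrow> \<phi> n y = 0" "\<And>n. \<phi> n (x n) = 1"
    "\<And>n y. y \<in> P \<Longrightarrow> y \<noteq> x n \<Longrightarrow> \<phi> n y = 0" "\<And>m n y. m \<noteq> n \<Longrightarrow> \<phi> m y = 0 \<or> \<phi> n y = 0"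
proof -
  have "\<exists>g. continuous_map X euclideanreal g \<and> (\<forall>y. 0 \<le> g y \<and> g y \<le> 1) \<and> g (x n) = (1::real)
      \<and> (\<forall>y. y \<notin> topspace X \<longrightarrow> g y = 0) \<and> (\<forall>y\<in>P. y \<noteq> x n \<longrightarrow> g y = 0)" for n
  proof -
    obtain V where V: "openin X V" "x n \<in> V" "V \<inter> P \<subseteq> {x n}"
      using isolated by blast
    have xn: "x n \<in> topspace X"
      using V openin_subset by blast
    obtain f where f: "continuous_map X (top_of_set {0..1::real}) f" "f (x n) = 0" "f ` (topspace X - V) \<subseteq> {1}"
      using X V xn unfolding completely_regular_space_def
      by (metis Diff_iff closedin_diff closedin_topspace)
    \<comment> \<open>The separating function \<open>f\<close> is 0 at \<open>x n\<close> and 1 off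
      \<open>V\<close>, hence the flip; outside the space its values are arbitrary and are reset to
      0.\<close>
    define g where "g y = (if y \<in> topspace X then 1 - f y else 0)" for y
    have "continuous_map X euclideanreal (\<lambda>y. 1 - f y)"
      using f(1) by (intro continuous_map_diff) (auto simp: continuous_map_in_subtopology)
    then have "continuous_map X euclideanreal g"
      by (rule continuous_map_eq) (simp add: g_def)
    moreover have "0 \<le> g y" "g y \<le> 1" for y
      using f(1) by (auto simp: g_def continuous_map_in_subtopology)
    moreover have "g y = 0" if "y \<in> P" "y \<noteq> x n" for y
      using that V(3) f(3) by (auto simp: g_def)
    ultimately show ?thesis
      using f(2) xn by (intro exI[of _ g]) (auto simp: g_def)
  qed
  then obtain g where g: "\<And>n. continuous_map X euclideanreal (g n)" "\<And>n y. 0 \<le> g n y" "\<And>n y. g n y \<le> 1"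
      "\<And>n. g n (x n) = (1::real)" "\<And>n y. y \<notin> topspace X \<Longrightarrow> g n y = 0"
      "\<And>n y. y \<in> P \<Longrightarrow> y \<noteq> x n \<Longrightarrow> g n y = 0"
    by metis
  text \<open>\<open>\<phi> n\<close> lives on \<open>g n > 1/2\<close> and, for \<open>j < n\<close>, on \<open>g j < 1/2\<close>.\<close>
  define \<phi> where "\<phi> n y = max 0 (2 * g n y - 1) * (\<Prod>j<n. max 0 (1 - 2 * g j y))" for n y
  show ?thesis
  proof
    show "continuous_map X euclideanreal (\<phi> n)" for n
      unfolding \<phi>_def
      by (intro continuous_map_real_mult continuous_map_prod continuous_map_real_max continuous_map_diff
          continuous_map_real_mult_left g) auto
    have prod: "0 \<le> (\<Prod>j<n. max 0 (1 - 2 * g j y))" "(\<Prod>j<n. max 0 (1 - 2 * g j y)) \<le> 1" for n y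
      using g(2) by (auto intro!: prod_nonneg prod_le_1)
    show "0 \<le> \<phi> n y" for n y
      using prod by (simp add: \<phi>_def)
    show "\<phi> n y \<le> 1" for n y
      using prod g(3)[of n y] by (simp add: \<phi>_def mult_le_one)
    show "\<phi> n y = 0" if "y \<notin> topspace X" for n y
      using that g(5) by (simp add: \<phi>_def)
    show "\<phi> n y = 0" if "y \<in> P" "y \<noteq> x n" for n y
      using that g(6) by (simp add: \<phi>_def)
    show "\<phi> n (x n) = 1" for n
    proof -
      have "g j (x n) = 0" if "j < n" for j
        using g(6) x that by (metis injD less_irrefl range_subsetD)
      then show ?thesis
        using g(4) by (simp add: \<phi>_def)
    qed
    have "\<phi> m y = 0 \<or> \<phi> n y = 0" if "m < n" for m n y
    proof (cases "g m y \<le> 1/2")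
      case False
      then have "\<exists>j\<in>{..<n}. max 0 (1 - 2 * g j y) = 0"
        using that by (intro bexI[of _ m]) auto
      then show ?thesis
        by (simp add: \<phi>_def prod_zero)
    qed (simp add: \<phi>_def)
    then show "\<phi> m y = 0 \<or> \<phi> n y = 0" if "m \<noteq> n" for m n y
      using that by (metis linorder_neqE_nat)
  qed
qed

section \<open>Averages along the density filter\<close>

text \<open>The indices with \<open>\<bar>u i\<bar> \<ge> e / 2\<close> have density zero, so with a
  bound \<open>B\<close> on \<open>u\<close> they contribute at most \<open>B\<close> times a
  vanishing proportion; the other indices contribute at most \<open>e / 2\<close>.\<close>

lemma Cesaro_density_filter:
  fixes u :: "nat \<Rightarrow> real"
  assumes u: "(u \<longlongrightarrow> 0) density_filter" and "bounded (range u)"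
  shows "(\<lambda>n. (\<Sum>i<n. \<bar>u i\<bar>) / n) \<longlonglongrightarrow> 0"
proof (rule LIMSEQ_I)
  fix e :: real assume "0 < e"
  obtain B where B: "\<And>i. \<bar>u i\<bar> \<le> B"
    using assms(2) by (auto simp: bounded_iff)
  define D where "D = {i. \<bar>u i\<bar> \<ge> e / 2}"
  have "\<forall>\<^sub>F i in density_filter. \<bar>u i\<bar> < e / 2"
    using tendstoD[OF u, of "e / 2"] \<open>0 < e\<close> by simp
  moreover have "UNIV - {i. \<bar>u i\<bar> < e / 2} = D"
    by (auto simp: D_def)
  ultimately have "(\<lambda>n. real (card (D \<inter> {0..<n})) / n) \<longlonglongrightarrow> 0"
    by (simp add: eventually_density_filter density_ideal_iff)
  then have "(\<lambda>n. B * (real (card (D \<inter> {0..<n})) / n)) \<longlonglongrightarrow> B * 0"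
    by (rule tendsto_mult_left)
  then have "\<forall>\<^sub>F n in sequentially. B * (real (card (D \<inter> {0..<n})) / n) < e / 2"
    using \<open>0 < e\<close> by (intro order_tendstoD) auto
  then obtain N where N: "\<And>n. n \<ge> N \<Longrightarrow> B * (real (card (D \<inter> {0..<n})) / n) < e / 2"
    by (auto simp: eventually_sequentially)
  \<comment> \<open>The lower bound 1 makes \<open>n\<close> positive, so that it cancels in
    \<open>n * (e / 2) / n\<close>.\<close>
  have "norm ((\<Sum>i<n. \<bar>u i\<bar>) / n - 0) < e" if "n \<ge> max N 1" for n
  proof -
    have "(\<Sum>i<n. \<bar>u i\<bar>) \<le> (\<Sum>i<n. e / 2 + (if i \<in> D then B else 0))"
      using B \<open>0 < e\<close> by (intro sum_mono) (auto simp: D_def intro: add_increasing)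
    also have "\<dots> = n * (e / 2) + B * card (D \<inter> {0..<n})"
      by (simp add: sum.distrib sum.If_cases lessThan_atLeast0 Int_commute)
    finally have "(\<Sum>i<n. \<bar>u i\<bar>) / n \<le> (n * (e / 2) + B * card (D \<inter> {0..<n})) / n"
      by (intro divide_right_mono) auto
    also have "\<dots> = e / 2 + B * (real (card (D \<inter> {0..<n})) / n)"
      using that by (simp add: add_divide_distrib)
    also have "\<dots> < e"
      using N[of n] that by linarith
    finally show ?thesis
      by (simp add: sum_nonneg)
  qed
  then show "\<exists>N. \<forall>n\<ge>N. norm ((\<Sum>i<n. \<bar>u i\<bar>) / n - 0) < e"
    by blast
qed

text \<open>Deleting from a long initial segment all indices that share an \<open>f\<close>-value
  with a fixed shorter segment removes less than half of it. The remaining block has new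
  \<open>f\<close>-values only, and its averages are at most twice the Cesaro means of
  \<open>\<bar>u\<bar>\<close>.\<close>

lemma averaging_blocks:
  fixes f :: "nat \<Rightarrow> nat"
  assumes f: "\<And>C. finite C \<Longrightarrow> f -` C \<in> density_ideal"
  obtains A :: "nat \<Rightarrow> nat set"
  where "\<And>k. finite (A k)" "\<And>k. A k \<noteq> {}" "\<And>j k. j \<noteq> k \<Longrightarrow> f ` A j \<inter> f ` A k = {}"
    "\<And>u. (u \<longlongrightarrow> 0) density_filter \<Longrightarrow> bounded (range u)
      \<Longrightarrow> (\<lambda>k. (\<Sum>i\<in>A k. u i) / card (A k)) \<longlonglongrightarrow> (0::real)"
proof -
  have step: "\<exists>n. m < n \<and> n \<le> 2 * card ({..<n} - f -` f ` {..<m})" for m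
  proof -
    define C where "C = f -` f ` {..<m}"
    have "(\<lambda>n. real (card (C \<inter> {0..<n})) / n) \<longlonglongrightarrow> 0"
      using f[of "f ` {..<m}"] by (simp add: C_def density_ideal_iff)
    then have "\<forall>\<^sub>F n in sequentially. real (card (C \<inter> {0..<n})) / n < 1 / 2"
      by (rule order_tendstoD) auto
    then obtain N where N: "\<And>n. n \<ge> N \<Longrightarrow> real (card (C \<inter> {0..<n})) / n < 1 / 2"
      by (auto simp: eventually_sequentially)
    \<comment> \<open>This \<open>n\<close> exceeds \<open>m\<close>, lies beyond the threshold
      \<open>N\<close>, and is positive, as clearing the denominator requires.\<close>
    define n where "n = Suc (max N m)"
    have "card ({..<n} - C) = n - card (C \<inter> {0..<n})"
      by (simp add: card_Diff_subset_Int lessThan_atLeast0 Int_commute)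
    moreover have "2 * card (C \<inter> {0..<n}) < n"
    proof -
      have "N \<le> n" "0 < n"
        by (auto simp: n_def)
      with N[of n] have "real (2 * card (C \<inter> {0..<n})) < real n"
        by (simp add: divide_less_eq)
      then show ?thesis
        by (simp only: of_nat_less_iff)
    qed
    ultimately have "n \<le> 2 * card ({..<n} - C)"
      by linarith
    then show ?thesis
      by (intro exI[of _ n]) (simp add: n_def C_def)
  qed
  obtain n where n: "\<And>k. n k < n (Suc k)" "\<And>k. n (Suc k) \<le> 2 * card ({..<n (Suc k)} - f -` f ` {..<n k})"
    using dependent_nat_choice[of "\<lambda>_ _. True" "\<lambda>_ m n. m < n \<and> n \<le> 2 * card ({..<n} - f -` f ` {..<m})"] step
    by auto
  have mono: "strict_mono n"
    using n(1) by (rule strict_monoI_Suc)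
  define A where "A k = {..<n (Suc k)} - f -` f ` {..<n k}" for k
  have card: "n (Suc k) \<le> 2 * card (A k)" for k
    using n(2) by (simp add: A_def)
  \<comment> \<open>The starting value \<open>n 0\<close> may be 0, but block \<open>k\<close> is
    cut from the segment below \<open>n (Suc k)\<close>, which is never empty.\<close>
  have pos: "0 < n (Suc k)" for k
    using n(1)[of k] by simp
  show ?thesis
  proof
    show fin: "finite (A k)" for k
      by (simp add: A_def)
    show "A k \<noteq> {}" for k
      using card[of k] pos[of k] by auto
    have "f ` A j \<inter> f ` A k = {}" if "j < k" for j k
    proof -
      \<comment> \<open>The whole block \<open>A j\<close> lies below \<open>n k\<close>, and
        \<open>A k\<close> avoids every \<open>f\<close>-value taken there.\<close>
      have "n (Suc j) \<le> n k"
        using mono that by (simp add: strict_mono_less_eq)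
      then have "f ` A j \<subseteq> f ` {..<n k}"
        by (auto simp: A_def)
      moreover have "f ` A k \<inter> f ` {..<n k} = {}"
        by (auto simp: A_def)
      ultimately show ?thesis
        by blast
    qed
    then show "f ` A j \<inter> f ` A k = {}" if "j \<noteq> k" for j k
      using that by (metis Int_commute linorder_neqE_nat)
    show "(\<lambda>k. (\<Sum>i\<in>A k. u i) / card (A k)) \<longlonglongrightarrow> 0"
      if "(u \<longlongrightarrow> 0) density_filter" "bounded (range u)" for u :: "nat \<Rightarrow> real"
    proof -
      from that have "(\<lambda>n. (\<Sum>i<n. \<bar>u i\<bar>) / n) \<longlonglongrightarrow> 0"
        by (rule Cesaro_density_filter)
      then have "(\<lambda>k. (\<Sum>i<n (Suc k). \<bar>u i\<bar>) / n (Suc k)) \<longlonglongrightarrow> 0"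
        by (rule filterlim_compose) (intro filterlim_subseq strict_monoI_Suc n(1))
      then have lim: "(\<lambda>k. 2 * ((\<Sum>i<n (Suc k). \<bar>u i\<bar>) / n (Suc k))) \<longlonglongrightarrow> 0"
        by (rule tendsto_mult_right_zero)
      have "norm ((\<Sum>i\<in>A k. u i) / card (A k)) \<le> 2 * ((\<Sum>i<n (Suc k). \<bar>u i\<bar>) / n (Suc k))" for k
      proof -
        have "\<bar>\<Sum>i\<in>A k. u i\<bar> \<le> (\<Sum>i\<in>A k. \<bar>u i\<bar>)"
          by (rule sum_abs)
        also have "\<dots> \<le> (\<Sum>i<n (Suc k). \<bar>u i\<bar>)"
          by (intro sum_mono2) (auto simp: A_def)
        \<comment> \<open>A block fills at least half of its segment; this gives the denominator
          \<open>n (Suc k) / 2\<close> and the factor 2.\<close>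
        finally have "\<bar>\<Sum>i\<in>A k. u i\<bar> / card (A k) \<le> (\<Sum>i<n (Suc k). \<bar>u i\<bar>) / (n (Suc k) / 2)"
          using card[of k] pos[of k] by (intro frac_le sum_nonneg) linarith+
        then show ?thesis
          by (simp add: mult.commute)
      qed
      then show ?thesis
        by (intro Lim_null_comparison[OF _ lim] always_eventually allI)
    qed
  qed
qed

section \<open>From the filter to the projection\<close>

lemma eventually_free_filter_notin_finite:
  assumes "free_filter F" "finite C"
  shows "\<forall>\<^sub>F n in F. n \<notin> C"
proof -
  have "\<forall>\<^sub>F n in F. n \<noteq> m" for m
  proof -
    obtain A where "\<forall>\<^sub>F n in F. n \<in> A" "m \<notin> A"
      using assms(1) unfolding free_filter_def by blast
    then show ?thesis
      by (auto elim: eventually_mono)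
  qed
  then have "\<forall>\<^sub>F n in F. \<forall>m\<in>C. n \<noteq> m"
    by (intro eventually_ball_finite assms(2)) auto
  then show ?thesis
    by (auto elim: eventually_mono)
qed

lemma tendsto_continuous_map_filter_space:
  assumes "continuous_map (filter_space F) euclidean g"
  shows "((\<lambda>n. g (Some n)) \<longlongrightarrow> g None) F"
proof (rule topological_tendstoI)
  fix U assume "open U" "g None \<in> U"
  then have "openin (filter_space F) {z. g z \<in> U}"
    using openin_continuous_map_preimage[OF assms, of U] by (simp add: topspace_filter_space)
  then show "\<forall>\<^sub>F n in F. g (Some n) \<in> U"
    using \<open>g None \<in> U\<close> by (simp add: openin_filter_space)
qed

theorem corollary1p3:
  fixes F :: "nat filter" and X :: "'a topology"
  assumes "free_filter F"
    and "F \<le>\<^sub>K density_filter"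
    and "completely_regular_space X" and "Hausdorff_space X"
    and "\<exists>e. embedding_map (filter_space F) X e"
  shows "contains_complemented_copy (Cp_star X) c0_p"
proof -
  obtain e where e: "embedding_map (filter_space F) X e"
    using assms(5) by blast
  obtain f where f: "filterlim f F density_filter"
    using assms(2) by (auto simp: katetov_le_iff_filterlim)
  from e have e_hom: "homeomorphic_map (filter_space F) (subtopology X (range e)) e"
    by (simp add: embedding_map_def topspace_filter_space)
  have e_cont: "continuous_map (filter_space F) X e"
    using homeomorphic_imp_continuous_map[OF e_hom] by (simp add: continuous_map_in_subtopology)
  have inj: "inj e"
    using homeomorphic_imp_injective_map[OF e_hom] by (simp add: topspace_filter_space)
  define x where "x n = e (Some n)" for n
  have x_inj: "inj x"
    using inj by (auto simp: x_def inj_def)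
  have isolated: "\<exists>V. openin X V \<and> x n \<in> V \<and> V \<inter> range e \<subseteq> {x n}" for n
  proof -
    \<comment> \<open>Singletons \<open>{Some n}\<close> are open in the filter space because they
      omit \<open>None\<close>.\<close>
    have "openin (subtopology X (range e)) (e ` {Some n})"
      using homeomorphic_imp_open_map[OF e_hom]
      by (metis open_map_def openin_filter_space option.distinct(1) singletonD)
    then show ?thesis
      unfolding openin_subtopology x_def by auto
  qed
  \<comment> \<open>Taking \<open>P\<close> to be all of \<open>range e\<close> makes the bumps
    vanish at the limit point \<open>e None\<close> as well.\<close>
  obtain \<phi> where \<phi>: "\<And>n. continuous_map X euclideanreal (\<phi> n)" "\<And>n y. 0 \<le> \<phi> n y" "\<And>n y. \<phi> n y \<le> 1"
      "\<And>n y. y \<notin> topspace X \<Longrightarrow> \<phi> n y = 0" "\<And>n. \<phi> n (x n) = (1::real)"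
      "\<And>n y. y \<in> range e \<Longrightarrow> y \<noteq> x n \<Longrightarrow> \<phi> n y = 0" "\<And>m n y. m \<noteq> n \<Longrightarrow> \<phi> m y = 0 \<or> \<phi> n y = 0"
    using disjoint_bumps[OF assms(3), of x "range e"] isolated x_inj by (auto simp: x_def)
  \<comment> \<open>A free filter contains all cofinite sets, so \<open>f\<close> leaves every
    finite set along the density filter.\<close>
  have "f -` C \<in> density_ideal" if "finite C" for C
  proof -
    have "\<forall>\<^sub>F i in density_filter. f i \<notin> C"
      using eventually_free_filter_notin_finite[OF assms(1) that] f by (rule eventually_compose_filterlim)
    moreover have "UNIV - {i. f i \<notin> C} = f -` C"
      by auto
    ultimately show ?thesis
      by (simp add: eventually_density_filter)
  qed
  then obtain A where A: "\<And>k. finite (A k)" "\<And>k. A k \<noteq> {}" "\<And>j k. j \<noteq> k \<Longrightarrow> f ` A j \<inter> f ` A k = {}"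
      "\<And>u. (u \<longlongrightarrow> 0) density_filter \<Longrightarrow> bounded (range u)
        \<Longrightarrow> (\<lambda>k. (\<Sum>i\<in>A k. u i) / card (A k)) \<longlonglongrightarrow> (0::real)"
    by (rule averaging_blocks) (auto intro: that)
  define h where "h k y = 1 - (\<Prod>b\<in>f ` A k. 1 - \<phi> b y)" for k y
  have h_0: "h k y = 0" if "\<And>b. b \<in> f ` A k \<Longrightarrow> \<phi> b y = 0" for k y
    using that by (simp add: h_def)
  have h_x: "h k (x b) = (if b \<in> f ` A k then 1 else 0)" for k b
  proof (cases "b \<in> f ` A k")
    case True
    then have "(\<Prod>b'\<in>f ` A k. 1 - \<phi> b' (x b)) = 0"
      using A(1) \<phi>(5) by (intro prod_zero) auto
    with True show ?thesis
      by (simp add: h_def)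
  next
    case False
    then show ?thesis
      by (auto simp: x_def inj_eq[OF inj] intro!: h_0 \<phi>(6))
  qed
  have h_p: "h k (e None) = 0" for k
    by (intro h_0 \<phi>(6)) (auto simp: x_def inj_eq[OF inj])
  obtain S where S: "continuous_on UNIV S" "linear S" "S ` c0_p \<subseteq> Cp_star X"
      "\<And>a k y. h k y \<noteq> 0 \<Longrightarrow> S a y = a k * h k y" "\<And>a y. (\<And>k. h k y = 0) \<Longrightarrow> S a y = 0"
  proof (rule disjoint_series[of X h])
    show "continuous_map X euclideanreal (h k)" for k
      unfolding h_def using A(1) by (intro continuous_map_diff continuous_map_prod \<phi>) auto
    have "0 \<le> (\<Prod>b\<in>f ` A k. 1 - \<phi> b y)" "(\<Prod>b\<in>f ` A k. 1 - \<phi> b y) \<le> 1" for k y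
      using \<phi>(2,3) by (auto intro!: prod_nonneg prod_le_1)
    then show "\<bar>h k y\<bar> \<le> 1" for k y
      by (simp add: h_def)
    show "h k y = 0" if "y \<notin> topspace X" for k y
      using \<phi>(4) that by (intro h_0)
    show "h j y = 0 \<or> h k y = 0" if "j \<noteq> k" for j k y
      using h_0 A(3)[OF that] \<phi>(7) by (metis disjoint_iff)
  qed blast
  \<comment> \<open>\<open>T g k\<close> is the integral of \<open>g\<close> against the
    \<open>k\<close>-th averaged measure, with repeated values of \<open>f\<close> counted with
    multiplicity. It depends on finitely many values of \<open>g\<close>, hence is continuous for
    the pointwise topology.\<close>
  define T where "T g k = (\<Sum>i\<in>A k. g (x (f i)) - g (e None)) / card (A k)" for g :: "'a \<Rightarrow> real" and k
  show ?thesis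
  proof (rule contains_complemented_copy_retract[OF subspace_Cp_star _ _ _ S(1-3)])
    have "continuous_on UNIV (\<lambda>g. T g k)" for k
      unfolding T_def
      using A(1,2) by (intro continuous_on_divide continuous_on_sum continuous_on_diff continuous_on_const
        continuous_on_product_coordinates) auto
    then show "continuous_on UNIV T"
      by (rule continuous_on_coordinatewise_then_product)
    show "linear T"
      by (intro linearI)
        (auto simp: T_def plus_fun_def scaleR_fun_def sum.distrib sum_subtractf sum_distrib_left
          right_diff_distrib diff_divide_distrib add_divide_distrib)
    show "T ` Cp_star X \<subseteq> c0_p"
    proof safe
      fix g assume "g \<in> Cp_star X"
      then have g: "continuous_map X euclideanreal g" "bounded (g ` topspace X)"
        by (auto simp: Cp_star_def)
      have top: "e z \<in> topspace X" for z
        using continuous_map_image_subset_topspace[OF e_cont] by (auto simp: topspace_filter_space)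
      have "((\<lambda>n. g (x n)) \<longlongrightarrow> g (e None)) F"
        using tendsto_continuous_map_filter_space[OF continuous_map_compose[OF e_cont g(1)]]
        by (simp add: x_def)
      \<comment> \<open>Continuity at the limit point gives convergence along \<open>F\<close>,
        which \<open>f\<close> transports to the density filter, where block averages apply.\<close>
      from filterlim_compose[OF this f]
      have "((\<lambda>i. g (x (f i)) - g (e None)) \<longlongrightarrow> 0) density_filter"
        by (simp add: LIM_zero_iff)
      moreover have "bounded (range (\<lambda>i. g (x (f i)) - g (e None)))"
        using g(2) top by (intro bounded_minus_comp bounded_subset[OF g(2)]) (auto simp: x_def)
      ultimately show "T g \<in> c0_p"
        using A(4) by (simp add: T_def[abs_def] c0_p_def)
    qed
    show "T (S a) = a" for a
    proof
      fix k
      \<comment> \<open>\<open>h k\<close> equals 1 at each point averaged in block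
        \<open>k\<close>, and every \<open>h\<close> vanishes at \<open>e None\<close>; all summands
        of \<open>T (S a) k\<close> are therefore \<open>a k\<close>.\<close>
      have "S a (x (f i)) = a k" if "i \<in> A k" for i
        using S(4)[of k "x (f i)" a] that by (simp add: h_x)
      moreover have "S a (e None) = 0"
        using S(5) h_p by blast
      ultimately show "T (S a) k = a k"
        using A(1,2) by (simp add: T_def)
    qed
  qed
qed

end
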